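(* Let $R=\{(0,2),(1,0),(3,0),(1,1),(1,2),(2,2),(3,1),(3,2),(3,3)\}$ and $R'=\{(0,1),(0,3),(2,0),(1,1),(1,3),(2,1),(2,2),(2,3),(3,3)\}$. Then $(123,R)\sim_{jd}(132,R)$ and $(123,R')\sim_{jd}(132,R')$.
   Context: $S_n$ is the set of permutations $\pi=\pi_1\cdots\pi_n$ of $\{1,\dots,n\}$. A mesh pattern of length $k$ is a pair $(\tau,R)$ with $\tau\in S_k$ and $R\subseteq\{0,\dots,k\}\times\{0,\dots,k\}$ (the set of shaded boxes; box $(a,b)$ is the unit square with lower-left corner $(a,b)$). An occurrence of $(\tau,R)$ in $\pi\in S_n$ is a subsequence $\pi_{i_1}\cdots\pi_{i_k}$, $i_1<\dots<i_k$, order-isomorphic to $\tau$, such that, with $i_0=0$, $i_{k+1}=n+1$, with $v_1<\dots<v_k$ the values $\pi_{i_1},\dots,\pi_{i_k}$ in increasing order, and $v_0=0$, $v_{k+1}=n+1$, for each $(a,b)\in R$ there is no index $m$ with $i_a<m<i_{a+1}$ and $v_b<\pi_m<v_{b+1}$. Two mesh patterns $q_1,q_2$ are jointly equidistributed, written $q_1\sim_{jd}q_2$, if for all nonnegative integers $n,k,\ell$ the number of $\pi\in S_n$ with exactly $k$ occurrences of $q_1$ and $\ell$ occurrences of $q_2$ equals the number of $\pi\in S_n$ with exactly $\ell$ occurrences of $q_1$ and $k$ occurrences of $q_2$. *)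

theory Defs
  imports "HOL-Combinatorics.Multiset_Permutations"
begin

text \<open>
  Permutations in \<open>S\<^sub>n\<close> are lists in one-line notation with entries \<open>1, \<dots>, n\<close>.
  Positions are counted from 1, as in \<open>\<pi> = \<pi>\<^sub>1 \<dots> \<pi>\<^sub>n\<close>.
\<close>

abbreviation Sym :: "nat \<Rightarrow> nat list set" where
  "Sym n \<equiv> permutations_of_set {1..n}"

definition entry :: "nat list \<Rightarrow> nat \<Rightarrow> nat" where
  "entry \<pi> m = \<pi> ! (m - 1)"

text \<open>
  A mesh pattern \<open>(\<tau>, R)\<close> of length \<open>k\<close>: \<open>\<tau> \<in> Sym k\<close> and \<open>R \<subseteq> {0..k} \<times> {0..k}\<close>.
\<close>

type_synonym mesh_pattern = "nat list \<times> (nat \<times> nat) set"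

definition is_mesh_pattern :: "mesh_pattern \<Rightarrow> bool" where
  "is_mesh_pattern q \<longleftrightarrow>
     (case q of (\<tau>, R) \<Rightarrow> \<tau> \<in> Sym (length \<tau>) \<and> R \<subseteq> {0..length \<tau>} \<times> {0..length \<tau>})"

text \<open>
  An occurrence is given by its list \<open>ix\<close> of positions \<open>i\<^sub>1 < \<dots> < i\<^sub>k\<close>; since the entries of
  \<open>\<pi>\<close> are distinct, this determines and is determined by the subsequence.
  The padded lists \<open>ix'\<close> and \<open>vs'\<close> satisfy \<open>ix' ! a = i\<^sub>a\<close> and \<open>vs' ! b = v\<^sub>b\<close> for
  \<open>0 \<le> a, b \<le> k + 1\<close>.
\<close>

definition mesh_occurrence :: "mesh_pattern \<Rightarrow> nat list \<Rightarrow> nat list \<Rightarrow> bool" where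
  "mesh_occurrence q \<pi> ix \<longleftrightarrow>
     (case q of (\<tau>, R) \<Rightarrow>
       let n = length \<pi>;
           k = length \<tau>;
           vals = map (entry \<pi>) ix;
           ix' = 0 # ix @ [n + 1];
           vs' = 0 # sort vals @ [n + 1]
       in length ix = k \<and> sorted_wrt (<) ix \<and> set ix \<subseteq> {1..n} \<and>
          (\<forall>s<k. \<forall>t<k. vals ! s < vals ! t \<longleftrightarrow> \<tau> ! s < \<tau> ! t) \<and>
          (\<forall>(a, b)\<in>R. \<not> (\<exists>m\<in>{1..n}. ix' ! a < m \<and> m < ix' ! (a + 1) \<and>
                                  vs' ! b < entry \<pi> m \<and> entry \<pi> m < vs' ! (b + 1))))"

definition mesh_count :: "mesh_pattern \<Rightarrow> nat list \<Rightarrow> nat" where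
  "mesh_count q \<pi> = card {ix. mesh_occurrence q \<pi> ix}"

definition jointly_equidistributed :: "mesh_pattern \<Rightarrow> mesh_pattern \<Rightarrow> bool"
    (infix "\<sim>\<^sub>j\<^sub>d" 50) where
  "q\<^sub>1 \<sim>\<^sub>j\<^sub>d q\<^sub>2 \<longleftrightarrow>
     (\<forall>n k l. card {\<pi> \<in> Sym n. mesh_count q\<^sub>1 \<pi> = k \<and> mesh_count q\<^sub>2 \<pi> = l} =
              card {\<pi> \<in> Sym n. mesh_count q\<^sub>1 \<pi> = l \<and> mesh_count q\<^sub>2 \<pi> = k})"

definition mesh_R :: "(nat \<times> nat) set" where
  "mesh_R = {(0,2), (1,0), (3,0), (1,1), (1,2), (2,2), (3,1), (3,2), (3,3)}"

definition mesh_R' :: "(nat \<times> nat) set" where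
  "mesh_R' = {(0,1), (0,3), (2,0), (1,1), (1,3), (2,1), (2,2), (2,3), (3,3)}"

lemma is_mesh_pattern_123_132:
  assumes "\<tau> \<in> {[1,2,3], [1,3,2]}" and "S \<in> {mesh_R, mesh_R'}"
  shows "is_mesh_pattern (\<tau>, S)"
  using assms
  by (auto simp: is_mesh_pattern_def permutations_of_set_def mesh_R_def mesh_R'_def
           atLeastAtMost_insertL numeral_3_eq_3)

end

theory Submission
  imports Defs
begin

text \<open>
  An occurrence of \<open>(123, R)\<close> or \<open>(132, R)\<close> in \<open>\<pi>\<close> must end in the last entry \<open>z\<close>, its middle
  entry is \<open>z - 1\<close> respectively \<open>z + 1\<close>, and its first entry is the closest entry smaller than \<open>z\<close>
  to the left of the middle one. Hence both counts are \<open>0\<close> or \<open>1\<close>, and for two such statistics joint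
  equidistribution amounts to equidistribution. Exchanging the values \<open>z\<close> and \<open>z - 1\<close> (\<open>1\<close> and \<open>n\<close> if
  \<open>z = 1\<close>) is a bijection of \<open>S\<^sub>n\<close> that carries the first count to the second. Finally \<open>R'\<close> is the
  transpose of \<open>R\<close> and \<open>123\<close>, \<open>132\<close> are involutions, so the claim for \<open>R'\<close> follows by passing to
  inverse permutations.
\<close>

declare One_nat_def [simp del]

section \<open>Permutations in one-line notation\<close>

lemma length_Sym: "\<pi> \<in> Sym n \<Longrightarrow> length \<pi> = n"
  by (auto simp: permutations_of_set_def dest: distinct_card)

lemma entry_image: "entry \<pi> ` {1..length \<pi>} = set \<pi>"
proof -
  have "{1..length \<pi>} = Suc ` {0..<length \<pi>}"
    by (simp add: One_nat_def atLeastLessThanSuc_atLeastAtMost)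
  then show ?thesis
    by (simp add: entry_def image_image nth_image del: image_Suc_atLeastLessThan)
qed

lemma Sym_iff_bij_betw: "\<pi> \<in> Sym n \<longleftrightarrow> length \<pi> = n \<and> bij_betw (entry \<pi>) {1..n} {1..n}"
proof
  assume \<pi>: "\<pi> \<in> Sym n"
  then have len: "length \<pi> = n" by (rule length_Sym)
  have img: "entry \<pi> ` {1..n} = {1..n}"
    using \<pi> entry_image[of \<pi>] len by (auto simp: permutations_of_set_def)
  have "inj_on (entry \<pi>) {1..n}"
    by (rule eq_card_imp_inj_on) (simp, simp only: img)
  with img len show "length \<pi> = n \<and> bij_betw (entry \<pi>) {1..n} {1..n}"
    by (simp add: bij_betw_def)
next
  assume *: "length \<pi> = n \<and> bij_betw (entry \<pi>) {1..n} {1..n}"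
  then have "set \<pi> = {1..n}"
    using entry_image[of \<pi>] by (auto simp: bij_betw_def)
  with * show "\<pi> \<in> Sym n"
    by (auto simp: permutations_of_set_def intro: card_distinct)
qed

lemma list_eq_if_entry_eq:
  assumes "length xs = n" "length ys = n" "\<And>m. m \<in> {1..n} \<Longrightarrow> entry xs m = entry ys m"
  shows "xs = ys"
proof (rule nth_equalityI)
  fix i assume "i < length xs"
  with assms(1) assms(3)[of "Suc i"] show "xs ! i = ys ! i" by (simp add: entry_def)
qed (use assms in simp)

lemma entry_map: "m \<in> {1..length xs} \<Longrightarrow> entry (map f xs) m = f (entry xs m)"
  by (auto simp: entry_def)

lemma map_mem_Sym:
  assumes "\<pi> \<in> Sym n" "bij_betw f {1..n} {1..n}"
  shows "map f \<pi> \<in> Sym n"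
  using assms by (auto simp: permutations_of_set_def distinct_map bij_betw_def)

section \<open>Inverse permutations\<close>

text \<open>The inverse is taken on positions from 1 on: since \<open>0 - 1 = 0\<close> for
  naturals, \<open>entry \<pi> 0\<close> and \<open>entry \<pi> 1\<close> coincide, so position 0
  has to stay outside.\<close>

definition inv_list :: "nat list \<Rightarrow> nat list" where
  "inv_list \<pi> = map (inv_into {1..length \<pi>} (entry \<pi>)) [1..<length \<pi> + 1]"

lemma length_inv_list [simp]: "length (inv_list \<pi>) = length \<pi>"
  by (simp add: inv_list_def del: upt_Suc)

lemma entry_inv_list:
  "v \<in> {1..length \<pi>} \<Longrightarrow> entry (inv_list \<pi>) v = inv_into {1..length \<pi>} (entry \<pi>) v"
  by (cases v) (simp_all add: inv_list_def entry_def One_nat_def del: upt_Suc)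

context
  fixes \<pi> n
  assumes \<pi>: "\<pi> \<in> Sym n"
begin

lemma entry_mem: "m \<in> {1..n} \<Longrightarrow> entry \<pi> m \<in> {1..n}"
  using \<pi> unfolding Sym_iff_bij_betw bij_betw_def by blast

lemma entry_eq_iff: "m \<in> {1..n} \<Longrightarrow> m' \<in> {1..n} \<Longrightarrow> entry \<pi> m = entry \<pi> m' \<longleftrightarrow> m = m'"
  using \<pi> unfolding Sym_iff_bij_betw bij_betw_def inj_on_def by blast

lemma entry_surj: "v \<in> {1..n} \<Longrightarrow> \<exists>m\<in>{1..n}. entry \<pi> m = v"
  using \<pi> unfolding Sym_iff_bij_betw bij_betw_def by (metis imageE)

lemma inv_list_mem: "inv_list \<pi> \<in> Sym n"
proof -
  have "bij_betw (inv_into {1..n} (entry \<pi>)) {1..n} {1..n}"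
    using \<pi> by (simp add: Sym_iff_bij_betw bij_betw_inv_into)
  then show ?thesis
    using length_Sym[OF \<pi>] entry_inv_list[of _ \<pi>]
      bij_betw_cong[of "{1..n}" "entry (inv_list \<pi>)" "inv_into {1..n} (entry \<pi>)" "{1..n}"]
    unfolding Sym_iff_bij_betw by simp
qed

lemma entry_inv_list_entry: "m \<in> {1..n} \<Longrightarrow> entry (inv_list \<pi>) (entry \<pi> m) = m"
  using \<pi> entry_mem[of m] entry_inv_list[of "entry \<pi> m" \<pi>]
  unfolding Sym_iff_bij_betw bij_betw_def by simp

lemma entry_entry_inv_list: "v \<in> {1..n} \<Longrightarrow> entry \<pi> (entry (inv_list \<pi>) v) = v"
  using entry_surj[of v] entry_inv_list_entry by metis

end

lemma inv_list_inv_list: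
  assumes "\<pi> \<in> Sym n"
  shows "inv_list (inv_list \<pi>) = \<pi>"
proof (rule list_eq_if_entry_eq[of _ n])
  fix m assume m: "m \<in> {1..n}"
  have "entry (inv_list (inv_list \<pi>)) (entry (inv_list \<pi>) (entry \<pi> m)) = entry \<pi> m"
    by (rule entry_inv_list_entry[OF inv_list_mem[OF assms] entry_mem[OF assms m]])
  with m show "entry (inv_list (inv_list \<pi>)) m = entry \<pi> m"
    by (simp only: entry_inv_list_entry[OF assms])
qed (use assms in \<open>simp_all add: length_Sym\<close>)

lemma bij_betw_inv_list: "bij_betw inv_list (Sym n) (Sym n)"
  by (rule bij_betw_byWitness[where f' = inv_list]) (auto simp: inv_list_inv_list inv_list_mem)

section \<open>Transposition of mesh patterns\<close>

text \<open>Reflecting the diagram of \<open>\<pi>\<close> in the main diagonal swaps positions and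
  values, so the reflected occurrence has the sorted values as its positions.\<close>

definition transpose_occ :: "nat list \<Rightarrow> nat list \<Rightarrow> nat list" where
  "transpose_occ \<pi> ix = sort (map (entry \<pi>) ix)"

text \<open>With the sorted values written as \<open>transpose_occ \<pi> ix\<close>, positions and
  values enter the box condition symmetrically; transposing a pattern then merely exchanges the two
  padded lists.\<close>

lemma mesh_occurrence_iff:
  "mesh_occurrence (\<tau>, R) \<pi> ix \<longleftrightarrow>
     length ix = length \<tau> \<and> sorted_wrt (<) ix \<and> set ix \<subseteq> {1..length \<pi>} \<and>
     (\<forall>s<length \<tau>. \<forall>t<length \<tau>. entry \<pi> (ix ! s) < entry \<pi> (ix ! t) \<longleftrightarrow> \<tau> ! s < \<tau> ! t) \<and>
     (\<forall>(a, b)\<in>R. \<not> (\<exists>m\<in>{1..length \<pi>}.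
        (0 # ix @ [length \<pi> + 1]) ! a < m \<and> m < (0 # ix @ [length \<pi> + 1]) ! (a + 1) \<and>
        (0 # transpose_occ \<pi> ix @ [length \<pi> + 1]) ! b < entry \<pi> m \<and>
        entry \<pi> m < (0 # transpose_occ \<pi> ix @ [length \<pi> + 1]) ! (b + 1)))"
  unfolding mesh_occurrence_def transpose_occ_def Let_def prod.case
  by (rule iffI; (elim conjE; intro conjI; simp))

lemma strict_sorted_eq:
  fixes xs ys :: "nat list"
  assumes "sorted_wrt (<) xs" "sorted_wrt (<) ys" "set xs = set ys"
  shows "xs = ys"
  using assms by (simp add: strict_sorted_equal)

text \<open>Going to values and back by the inverse permutation restores the set of positions, and a
  strictly increasing list is determined by its set.\<close>

lemma
  assumes "\<pi> \<in> Sym n" "sorted_wrt (<) ix" "set ix \<subseteq> {1..n}"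
  shows sorted_transpose_occ: "sorted_wrt (<) (transpose_occ \<pi> ix)"
    and transpose_occ_transpose_occ: "transpose_occ (inv_list \<pi>) (transpose_occ \<pi> ix) = ix"
proof -
  \<comment> \<open>General in \<open>\<pi>\<close> and \<open>ix\<close> because it is used a
    second time, for \<open>inv_list \<pi>\<close> and the already transposed occurrence.\<close>
  have sorted: "sorted_wrt (<) (transpose_occ \<pi> ix)"
    if "\<pi> \<in> Sym n" "sorted_wrt (<) ix" "set ix \<subseteq> {1..n}" for \<pi> ix
  proof -
    have "inj_on (entry \<pi>) (set ix)"
      using that unfolding Sym_iff_bij_betw bij_betw_def by (blast intro: inj_on_subset)
    with that show ?thesis
      by (simp add: transpose_occ_def strict_sorted_iff distinct_map)
  qed
  then show *: "sorted_wrt (<) (transpose_occ \<pi> ix)"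
    using assms by blast
  have sub: "set (transpose_occ \<pi> ix) \<subseteq> {1..n}"
    using assms entry_mem[OF assms(1)] by (force simp: transpose_occ_def)
  have "(\<lambda>m. entry (inv_list \<pi>) (entry \<pi> m)) ` set ix = (\<lambda>m. m) ` set ix"
    by (rule image_cong) (use assms entry_inv_list_entry[OF assms(1)] in auto)
  then have "set (transpose_occ (inv_list \<pi>) (transpose_occ \<pi> ix)) = set ix"
    by (simp add: transpose_occ_def image_image)
  with assms * sub show "transpose_occ (inv_list \<pi>) (transpose_occ \<pi> ix) = ix"
    by (intro strict_sorted_eq sorted) (auto intro: inv_list_mem)
qed

text \<open>Reflection in the main diagonal turns \<open>\<pi>\<close> and \<open>\<tau>\<close>
  into their inverses and box (a, b) into box (b, a).\<close>

lemma mesh_occurrence_transpose: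
  assumes \<pi>: "\<pi> \<in> Sym n" and \<tau>: "\<tau> \<in> Sym k" and occ: "mesh_occurrence (\<tau>, R) \<pi> ix"
  shows "mesh_occurrence (inv_list \<tau>, R\<inverse>) (inv_list \<pi>) (transpose_occ \<pi> ix)"
proof -
  note [simp] = length_Sym[OF \<pi>] length_Sym[OF \<tau>]
  let ?\<tau>' = "inv_list \<tau>" and ?\<pi>' = "inv_list \<pi>" and ?ys = "transpose_occ \<pi> ix"
  from occ have len: "length ix = k" and srt: "sorted_wrt (<) ix" and sub: "set ix \<subseteq> {1..n}"
    and ord: "\<And>s t. s < k \<Longrightarrow> t < k \<Longrightarrow> entry \<pi> (ix ! s) < entry \<pi> (ix ! t) \<longleftrightarrow> \<tau> ! s < \<tau> ! t"
    and box: "\<And>a b m. (a, b) \<in> R \<Longrightarrow> m \<in> {1..n} \<Longrightarrow>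
        \<not> ((0 # ix @ [n + 1]) ! a < m \<and> m < (0 # ix @ [n + 1]) ! (a + 1) \<and>
        (0 # ?ys @ [n + 1]) ! b < entry \<pi> m \<and> entry \<pi> m < (0 # ?ys @ [n + 1]) ! (b + 1))"
    unfolding mesh_occurrence_iff by auto
  have len': "length ?ys = k" by (simp add: transpose_occ_def len)
  have sub': "set ?ys \<subseteq> {1..n}"
    using sub entry_mem[OF \<pi>] by (force simp: transpose_occ_def)
  have ys'': "transpose_occ ?\<pi>' ?ys = ix"
    using \<pi> srt sub by (rule transpose_occ_transpose_occ)
  have \<tau>'_mem: "?\<tau>' ! s - 1 < k" "?\<tau>' ! s \<ge> 1" if "s < k" for s
    using entry_mem[OF inv_list_mem[OF \<tau>], of "Suc s"] that by (auto simp: entry_def)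
  have \<tau>_\<tau>': "\<tau> ! (?\<tau>' ! s - 1) = Suc s" if "s < k" for s
    using entry_entry_inv_list[OF \<tau>, of "Suc s"] that by (simp add: entry_def)
  \<comment> \<open>The value of rank \<open>Suc s\<close> in the occurrence stands at pattern
    position \<tau>^{-1}(s+1), whose list index is one less. Both lists are strictly increasing, so
    comparing their sets is enough.\<close>
  have ys: "?ys = map (\<lambda>s. entry \<pi> (ix ! (?\<tau>' ! s - 1))) [0..<k]" (is "_ = ?zs")
  proof (rule strict_sorted_eq)
    show "sorted_wrt (<) ?ys"
      using \<pi> srt sub by (rule sorted_transpose_occ)
    show "sorted_wrt (<) ?zs"
      by (simp add: sorted_wrt_iff_nth_less ord \<tau>'_mem \<tau>_\<tau>')
    \<comment> \<open>An injective self-map of a finite set is onto, so the right-hand list misses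
      no value of the occurrence.\<close>
    have "(\<lambda>s. ?\<tau>' ! s - 1) ` {0..<k} = {0..<k}"
    proof (rule endo_inj_surj)
      show "inj_on (\<lambda>s. ?\<tau>' ! s - 1) {0..<k}"
        by (rule inj_onI) (metis \<tau>_\<tau>' atLeastLessThan_iff nat.inject)
    qed (auto simp: \<tau>'_mem)
    then have "set ?zs = (\<lambda>j. entry \<pi> (ix ! j)) ` {0..<k}"
      by (simp add: image_image[symmetric, of "\<lambda>j. entry \<pi> (ix ! j)" "\<lambda>s. ?\<tau>' ! s - 1"])
    also have "\<dots> = set ?ys"
      using len by (force simp: transpose_occ_def in_set_conv_nth)
    finally show "set ?ys = set ?zs" ..
  qed
  have \<pi>'_ys: "entry ?\<pi>' (?ys ! s) = ix ! (?\<tau>' ! s - 1)" if "s < k" for s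
  proof -
    have "ix ! (?\<tau>' ! s - 1) \<in> {1..n}"
      using sub len \<tau>'_mem(1)[OF that] nth_mem by blast
    then show ?thesis
      using that by (simp add: ys entry_inv_list_entry[OF \<pi>])
  qed
  have ix_less: "ix ! i < ix ! j \<longleftrightarrow> i < j" if "i < k" "j < k" for i j
    using srt len that by (metis linorder_neqE_nat less_asym sorted_wrt_nth_less)
  have ord': "entry ?\<pi>' (?ys ! s) < entry ?\<pi>' (?ys ! t) \<longleftrightarrow> ?\<tau>' ! s < ?\<tau>' ! t"
    if "s < k" "t < k" for s t
    using \<tau>'_mem[OF that(1)] \<tau>'_mem[OF that(2)] by (auto simp: \<pi>'_ys that ix_less)
  \<comment> \<open>The point of the inverse at position \<open>m\<close> is the point of
    \<open>\<pi>\<close> at position \<open>entry ?\<pi>' m\<close> with value \<open>m\<close>; the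
    box condition for \<open>\<pi>\<close> is applied there.\<close>
  have box': "\<not> ((0 # ?ys @ [n + 1]) ! b < m \<and> m < (0 # ?ys @ [n + 1]) ! (b + 1) \<and>
      (0 # ix @ [n + 1]) ! a < entry ?\<pi>' m \<and> entry ?\<pi>' m < (0 # ix @ [n + 1]) ! (a + 1))"
    if "(a, b) \<in> R" "m \<in> {1..n}" for a b m
    using box[OF that(1) entry_mem[OF inv_list_mem[OF \<pi>] that(2)]]
    unfolding entry_entry_inv_list[OF \<pi> that(2)] by blast
  show ?thesis
    unfolding mesh_occurrence_iff ys''
    using len' sub' ord' box' sorted_transpose_occ[OF \<pi> srt sub] by auto
qed

lemma mesh_count_transpose:
  assumes \<pi>: "\<pi> \<in> Sym n" and \<tau>: "\<tau> \<in> Sym k"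
  shows "mesh_count (inv_list \<tau>, R\<inverse>) (inv_list \<pi>) = mesh_count (\<tau>, R) \<pi>"
proof -
  let ?A = "{ix. mesh_occurrence (\<tau>, R) \<pi> ix}"
  let ?B = "{ix. mesh_occurrence (inv_list \<tau>, R\<inverse>) (inv_list \<pi>) ix}"
  have "bij_betw (transpose_occ \<pi>) ?A ?B"
  proof (rule bij_betw_byWitness[where f' = "transpose_occ (inv_list \<pi>)"])
    show "\<forall>ix\<in>?A. transpose_occ (inv_list \<pi>) (transpose_occ \<pi> ix) = ix"
      using transpose_occ_transpose_occ[OF \<pi>] length_Sym[OF \<pi>]
      by (auto simp: mesh_occurrence_iff)
    show "\<forall>ix\<in>?B. transpose_occ \<pi> (transpose_occ (inv_list \<pi>) ix) = ix"
      using transpose_occ_transpose_occ[OF inv_list_mem[OF \<pi>]] length_Sym[OF \<pi>]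
        inv_list_inv_list[OF \<pi>]
      by (auto simp: mesh_occurrence_iff)
    show "transpose_occ \<pi> ` ?A \<subseteq> ?B"
      using mesh_occurrence_transpose[OF \<pi> \<tau>] by auto
    show "transpose_occ (inv_list \<pi>) ` ?B \<subseteq> ?A"
      using mesh_occurrence_transpose[OF inv_list_mem[OF \<pi>] inv_list_mem[OF \<tau>], of "R\<inverse>"]
        inv_list_inv_list[OF \<pi>] inv_list_inv_list[OF \<tau>]
      by auto
  qed
  then show ?thesis
    unfolding mesh_count_def by (rule bij_betw_same_card[symmetric])
qed

text \<open>Inversion permutes \<open>Sym n\<close> and transports both counts at once, so the joint
  distribution of the transposed pair is that of the original pair.\<close>

lemma jointly_equidistributed_transpose:
  assumes \<sigma>: "\<sigma> \<in> Sym j" and \<tau>: "\<tau> \<in> Sym k" and jd: "(\<sigma>, R) \<sim>\<^sub>j\<^sub>d (\<tau>, S)"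
  shows "(inv_list \<sigma>, R\<inverse>) \<sim>\<^sub>j\<^sub>d (inv_list \<tau>, S\<inverse>)"
proof -
  have "card {\<pi> \<in> Sym n. mesh_count (inv_list \<sigma>, R\<inverse>) \<pi> = a \<and> mesh_count (inv_list \<tau>, S\<inverse>) \<pi> = b} =
        card {\<pi> \<in> Sym n. mesh_count (\<sigma>, R) \<pi> = a \<and> mesh_count (\<tau>, S) \<pi> = b}"
    (is "card {\<pi> \<in> _. ?P \<pi>} = card {\<pi> \<in> _. ?Q \<pi>}") for n a b
  proof -
    have "bij_betw inv_list {\<pi> \<in> Sym n. ?Q \<pi>} {\<pi> \<in> Sym n. ?P \<pi>}"
      by (rule bij_betw_Collect[OF bij_betw_inv_list])
        (simp add: mesh_count_transpose[OF _ \<sigma>] mesh_count_transpose[OF _ \<tau>])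
    then show ?thesis by (rule bij_betw_same_card[symmetric])
  qed
  with jd show ?thesis
    unfolding jointly_equidistributed_def by simp
qed

section \<open>The patterns with shading \<open>R\<close>\<close>

text \<open>For counts in {0, 1} only the pairs (1, 0) and (0, 1) have to be compared. Their classes
  arise from the two classes of equal size in \<open>equi\<close> by removing the same class (1,
  1).\<close>

lemma jointly_equidistributed_if_01:
  assumes le1: "\<And>n \<pi>. \<pi> \<in> Sym n \<Longrightarrow> mesh_count q\<^sub>1 \<pi> \<le> 1 \<and> mesh_count q\<^sub>2 \<pi> \<le> 1"
    and equi: "\<And>n. card {\<pi> \<in> Sym n. mesh_count q\<^sub>1 \<pi> = 1} = card {\<pi> \<in> Sym n. mesh_count q\<^sub>2 \<pi> = 1}"
  shows "q\<^sub>1 \<sim>\<^sub>j\<^sub>d q\<^sub>2"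
  unfolding jointly_equidistributed_def
proof (intro allI)
  fix n k l :: nat
  define N where "N k l = {\<pi> \<in> Sym n. mesh_count q\<^sub>1 \<pi> = k \<and> mesh_count q\<^sub>2 \<pi> = l}" for k l
  have fin: "finite (N k l)" for k l by (simp add: N_def)
  have "{\<pi> \<in> Sym n. mesh_count q\<^sub>1 \<pi> = 1} = N 1 0 \<union> N 1 1"
    using le1 by (auto simp: N_def le_Suc_eq One_nat_def)
  moreover have "{\<pi> \<in> Sym n. mesh_count q\<^sub>2 \<pi> = 1} = N 0 1 \<union> N 1 1"
    using le1 by (auto simp: N_def le_Suc_eq One_nat_def)
  moreover have "N 1 0 \<inter> N 1 1 = {}" "N 0 1 \<inter> N 1 1 = {}" by (auto simp: N_def)
  ultimately have eq: "card (N 1 0) = card (N 0 1)"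
    using equi[of n] by (simp add: card_Un_disjoint fin)
  have empty: "N k l = {}" if "k > 1 \<or> l > 1" for k l :: nat
    using le1 that by (force simp: N_def)
  consider "k = l" | "k > 1 \<or> l > 1" | "k = 1" "l = 0" | "k = 0" "l = 1" by linarith
  then have "card (N k l) = card (N l k)"
    by cases (use eq empty[of k l] empty[of l k] in auto)
  then show "card {\<pi> \<in> Sym n. mesh_count q\<^sub>1 \<pi> = k \<and> mesh_count q\<^sub>2 \<pi> = l} =
        card {\<pi> \<in> Sym n. mesh_count q\<^sub>1 \<pi> = l \<and> mesh_count q\<^sub>2 \<pi> = k}"
    by (simp add: N_def)
qed

section \<open>Occurrences for the shading \<open>mesh_R\<close>\<close>

text \<open>The shading consists of the full row 2 (no value between y and z), the full column 3
  (nothing right of c) and the part of column 1 below z. The values enter only as a set, so the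
  lemma serves 123 and 132 alike.\<close>

lemma boxes_mesh_R:
  assumes \<pi>: "\<pi> \<in> Sym n" and pos: "1 \<le> a" "a < b" "b < c" "c \<le> n"
    and vals: "{entry \<pi> a, entry \<pi> b, entry \<pi> c} = {x, y, z}" "x < y" "y < z"
  shows "(\<forall>(i, j)\<in>mesh_R. \<not> (\<exists>m\<in>{1..n}.
        (0 # [a, b, c] @ [n + 1]) ! i < m \<and> m < (0 # [a, b, c] @ [n + 1]) ! (i + 1) \<and>
        (0 # [x, y, z] @ [n + 1]) ! j < entry \<pi> m \<and> entry \<pi> m < (0 # [x, y, z] @ [n + 1]) ! (j + 1)))
    \<longleftrightarrow> c = n \<and> z = y + 1 \<and> (\<forall>m. a < m \<and> m < b \<longrightarrow> z < entry \<pi> m)" (is "?boxes \<longleftrightarrow> ?rhs")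
proof -
  \<comment> \<open>Boxes are open, so points on grid lines escape them; a point sharing a
    horizontal line with a chosen point is that point.\<close>
  have other: "entry \<pi> m \<notin> {x, y, z}" if "m \<in> {1..n}" "m \<notin> {a, b, c}" for m
    unfolding vals(1)[symmetric] using that pos by (auto simp: entry_eq_iff[OF \<pi>])
  have range: "1 \<le> entry \<pi> m" "entry \<pi> m \<le> n" if "m \<in> {1..n}" for m
    using entry_mem[OF \<pi> that] by auto
  have "{x, y, z} \<subseteq> {1..n}"
    unfolding vals(1)[symmetric] using pos entry_mem[OF \<pi>] by auto
  then have xyz: "1 \<le> x" "z \<le> n" by auto
  have boxes: "?boxes \<longleftrightarrow> (\<forall>m\<in>{1..n}.
      (y < entry \<pi> m \<and> entry \<pi> m < z \<longrightarrow> m \<in> {a, b, c}) \<and>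
      (c < m \<longrightarrow> entry \<pi> m \<in> {x, y, z}) \<and>
      (a < m \<and> m < b \<longrightarrow> entry \<pi> m \<in> {x, y} \<or> z \<le> entry \<pi> m))" (is "_ \<longleftrightarrow> (\<forall>m\<in>_. ?B m)")
  proof -
    \<comment> \<open>One conjunct per shaded box, in the order in which \<open>mesh_R\<close> lists
      them.\<close>
    have "?boxes \<longleftrightarrow> (\<forall>m\<in>{1..n}.
        \<not> (0 < m \<and> m < a \<and> y < entry \<pi> m \<and> entry \<pi> m < z) \<and>
        \<not> (a < m \<and> m < b \<and> 0 < entry \<pi> m \<and> entry \<pi> m < x) \<and>
        \<not> (c < m \<and> m < n + 1 \<and> 0 < entry \<pi> m \<and> entry \<pi> m < x) \<and>
        \<not> (a < m \<and> m < b \<and> x < entry \<pi> m \<and> entry \<pi> m < y) \<and>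
        \<not> (a < m \<and> m < b \<and> y < entry \<pi> m \<and> entry \<pi> m < z) \<and>
        \<not> (b < m \<and> m < c \<and> y < entry \<pi> m \<and> entry \<pi> m < z) \<and>
        \<not> (c < m \<and> m < n + 1 \<and> x < entry \<pi> m \<and> entry \<pi> m < y) \<and>
        \<not> (c < m \<and> m < n + 1 \<and> y < entry \<pi> m \<and> entry \<pi> m < z) \<and>
        \<not> (c < m \<and> m < n + 1 \<and> z < entry \<pi> m \<and> entry \<pi> m < n + 1))"
      (is "_ \<longleftrightarrow> (\<forall>m\<in>_. ?E m)")
      by (simp add: mesh_R_def One_nat_def ball_conj_distrib del: atLeastAtMost_iff not_gr_zero not_gr0 neq0_conv)
    also have "\<dots> \<longleftrightarrow> (\<forall>m\<in>{1..n}. ?B m)"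
    proof (rule ball_cong[OF refl])
      fix m assume "m \<in> {1..n}"
      with range[OF this] have "1 \<le> m" "m \<le> n" "1 \<le> entry \<pi> m" "entry \<pi> m \<le> n" by auto
      moreover consider "m < a" | "m = a" | "a < m" "m < b" | "m = b" | "b < m" "m < c" | "m = c" | "c < m"
        by linarith
      then show "?E m \<longleftrightarrow> ?B m"
        by cases (use calculation pos vals(2,3) in auto)
    qed
    finally show ?thesis .
  qed
  show ?thesis
  proof
    assume ?boxes
    then have B: "\<forall>m\<in>{1..n}. ?B m" using boxes by simp
    \<comment> \<open>If c < n, the last entry would lie in column 3 without being a chosen
      point.\<close>
    have "c = n"
      using B other[of n] pos by force
    moreover have "z = y + 1"
    proof (rule ccontr)
      assume "z \<noteq> y + 1"
      \<comment> \<open>The value y + 1 would lie strictly inside row 2, hence belong to a chosen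
        point; but those have values x, y, z only.\<close>
      with vals xyz obtain m where m: "m \<in> {1..n}" "entry \<pi> m = y + 1"
        using entry_surj[OF \<pi>, of "y + 1"] by auto
      have "m \<in> {a, b, c}" using B m \<open>z \<noteq> y + 1\<close> vals by auto
      then have "entry \<pi> m \<in> {x, y, z}" unfolding vals(1)[symmetric] by auto
      with m \<open>z \<noteq> y + 1\<close> vals show False by auto
    qed
    moreover have "z < entry \<pi> m" if "a < m" "m < b" for m
      using B other[of m] pos that by force
    ultimately show ?rhs by blast
  next
    assume ?rhs
    then show ?boxes unfolding boxes by auto
  qed
qed

lemma order_123_iff:
  "(\<forall>s<length [1::nat,2,3]. \<forall>t<length [1::nat,2,3]. entry \<pi> ([a,b,c] ! s) < entry \<pi> ([a,b,c] ! t) \<longleftrightarrow> [1,2,3::nat] ! s < [1,2,3] ! t) \<longleftrightarrow>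
     entry \<pi> a < entry \<pi> b \<and> entry \<pi> b < entry \<pi> c"
  by (auto simp: All_less_Suc)

lemma order_132_iff:
  "(\<forall>s<length [1::nat,3,2]. \<forall>t<length [1::nat,3,2]. entry \<pi> ([a,b,c] ! s) < entry \<pi> ([a,b,c] ! t) \<longleftrightarrow> [1,3,2::nat] ! s < [1,3,2] ! t) \<longleftrightarrow>
     entry \<pi> a < entry \<pi> c \<and> entry \<pi> c < entry \<pi> b"
  by (auto simp: All_less_Suc)

lemma mesh_occurrence_123_iff:
  assumes \<pi>: "\<pi> \<in> Sym n"
  shows "mesh_occurrence ([1,2,3], mesh_R) \<pi> ix \<longleftrightarrow>
    (\<exists>a b. ix = [a, b, n] \<and> 1 \<le> a \<and> a < b \<and> b < n \<and> entry \<pi> a < entry \<pi> b \<and>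
       entry \<pi> n = entry \<pi> b + 1 \<and> (\<forall>m. a < m \<and> m < b \<longrightarrow> entry \<pi> n < entry \<pi> m))"
    (is "_ \<longleftrightarrow> (\<exists>a b. ix = [a, b, n] \<and> ?P a b)")
proof -
  have "mesh_occurrence ([1,2,3], mesh_R) \<pi> [a, b, c] \<longleftrightarrow> c = n \<and> ?P a b" for a b c
  proof (cases "1 \<le> a \<and> a < b \<and> b < c \<and> c \<le> n \<and> entry \<pi> a < entry \<pi> b \<and> entry \<pi> b < entry \<pi> c")
    case True
    then have "transpose_occ \<pi> [a, b, c] = [entry \<pi> a, entry \<pi> b, entry \<pi> c]"
      by (simp add: transpose_occ_def)
    moreover have "{entry \<pi> a, entry \<pi> b, entry \<pi> c} = {entry \<pi> a, entry \<pi> b, entry \<pi> c}"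
      by auto
    ultimately show ?thesis
      unfolding mesh_occurrence_iff length_Sym[OF \<pi>] order_123_iff
      using boxes_mesh_R[OF \<pi>, of a b c "entry \<pi> a" "entry \<pi> b" "entry \<pi> c"] True
      by (simp only:) auto
  next
    case False
    then show ?thesis
      unfolding mesh_occurrence_iff length_Sym[OF \<pi>] order_123_iff by auto
  qed
  moreover have "\<exists>a b c. ix = [a, b, c]" if "mesh_occurrence ([1,2,3], mesh_R) \<pi> ix"
    using that by (auto simp: mesh_occurrence_iff length_Suc_conv numeral_3_eq_3)
  ultimately show ?thesis by blast
qed

text \<open>Sorting the values now puts the last entry second and the middle entry third, so y and z
  of \<open>boxes_mesh_R\<close> trade places compared with 123.\<close>

lemma mesh_occurrence_132_iff:
  assumes \<pi>: "\<pi> \<in> Sym n"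
  shows "mesh_occurrence ([1,3,2], mesh_R) \<pi> ix \<longleftrightarrow>
    (\<exists>a b. ix = [a, b, n] \<and> 1 \<le> a \<and> a < b \<and> b < n \<and> entry \<pi> a < entry \<pi> n \<and>
       entry \<pi> b = entry \<pi> n + 1 \<and> (\<forall>m. a < m \<and> m < b \<longrightarrow> entry \<pi> b < entry \<pi> m))"
    (is "_ \<longleftrightarrow> (\<exists>a b. ix = [a, b, n] \<and> ?P a b)")
proof -
  have "mesh_occurrence ([1,3,2], mesh_R) \<pi> [a, b, c] \<longleftrightarrow> c = n \<and> ?P a b" for a b c
  proof (cases "1 \<le> a \<and> a < b \<and> b < c \<and> c \<le> n \<and> entry \<pi> a < entry \<pi> c \<and> entry \<pi> c < entry \<pi> b")
    case True
    then have "transpose_occ \<pi> [a, b, c] = [entry \<pi> a, entry \<pi> c, entry \<pi> b]"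
      by (simp add: transpose_occ_def)
    moreover have "{entry \<pi> a, entry \<pi> b, entry \<pi> c} = {entry \<pi> a, entry \<pi> c, entry \<pi> b}"
      by auto
    ultimately show ?thesis
      unfolding mesh_occurrence_iff length_Sym[OF \<pi>] order_132_iff
      using boxes_mesh_R[OF \<pi>, of a b c "entry \<pi> a" "entry \<pi> c" "entry \<pi> b"] True
      by (simp only:) auto
  next
    case False
    then show ?thesis
      unfolding mesh_occurrence_iff length_Sym[OF \<pi>] order_132_iff by auto
  qed
  moreover have "\<exists>a b c. ix = [a, b, c]" if "mesh_occurrence ([1,3,2], mesh_R) \<pi> ix"
    using that by (auto simp: mesh_occurrence_iff length_Suc_conv numeral_3_eq_3)
  ultimately show ?thesis by blast
qed

section \<open>Both counts as indicators\<close>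

text \<open>The largest admissible index is the nearest one. This upgrades any smaller entry left of
  b to one that respects the shading of column 1.\<close>

lemma nearest_smaller_exists:
  fixes f :: "nat \<Rightarrow> nat"
  assumes "1 \<le> a" "a < b" "f a < v"
  obtains a' where "1 \<le> a'" "a' < b" "f a' < v" "\<And>m. a' < m \<Longrightarrow> m < b \<Longrightarrow> v \<le> f m"
proof -
  let ?A = "{a. 1 \<le> a \<and> a < b \<and> f a < v}"
  have fin: "finite ?A" by simp
  have "Max ?A \<in> ?A"
    using assms by (intro Max_in fin) auto
  moreover have "v \<le> f m" if "Max ?A < m" "m < b" for m
  proof (rule ccontr)
    assume "\<not> v \<le> f m"
    with that calculation have "m \<in> ?A" by auto
    with fin have "m \<le> Max ?A" by (rule Max_ge)
    with that show False by simp
  qed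
  ultimately show thesis by (auto intro: that)
qed

lemma mesh_count_eq_of_bool:
  assumes "\<And>ix ix'. mesh_occurrence q \<pi> ix \<Longrightarrow> mesh_occurrence q \<pi> ix' \<Longrightarrow> ix = ix'"
  shows "mesh_count q \<pi> = of_bool (\<exists>ix. mesh_occurrence q \<pi> ix)"
proof (cases "\<exists>ix. mesh_occurrence q \<pi> ix")
  case True
  then obtain ix where "mesh_occurrence q \<pi> ix" by blast
  with assms have "{ix. mesh_occurrence q \<pi> ix} = {ix}" by blast
  with True show ?thesis by (simp add: mesh_count_def)
qed (simp add: mesh_count_def)

text \<open>Uniqueness: the value \<open>entry \<pi> n - 1\<close> determines b, and the shading
  then leaves only the nearest smaller entry for a. Existence: replace any smaller entry left of b
  by the nearest one.\<close>

lemma mesh_count_123: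
  assumes \<pi>: "\<pi> \<in> Sym n"
  shows "mesh_count ([1,2,3], mesh_R) \<pi> =
    of_bool (\<exists>a b. 1 \<le> a \<and> a < b \<and> b < n \<and> entry \<pi> a < entry \<pi> b \<and> entry \<pi> n = entry \<pi> b + 1)"
proof -
  have "mesh_count ([1,2,3], mesh_R) \<pi> = of_bool (\<exists>ix. mesh_occurrence ([1,2,3], mesh_R) \<pi> ix)"
  proof (rule mesh_count_eq_of_bool)
    fix ix ix'
    assume "mesh_occurrence ([1,2,3], mesh_R) \<pi> ix" "mesh_occurrence ([1,2,3], mesh_R) \<pi> ix'"
    then obtain a b a' b' where
      *: "ix = [a, b, n]" "1 \<le> a" "a < b" "b < n" "entry \<pi> a < entry \<pi> b"
        "entry \<pi> n = entry \<pi> b + 1" "\<And>m. a < m \<Longrightarrow> m < b \<Longrightarrow> entry \<pi> n < entry \<pi> m" and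
      **: "ix' = [a', b', n]" "1 \<le> a'" "a' < b'" "b' < n" "entry \<pi> a' < entry \<pi> b'"
        "entry \<pi> n = entry \<pi> b' + 1" "\<And>m. a' < m \<Longrightarrow> m < b' \<Longrightarrow> entry \<pi> n < entry \<pi> m"
      unfolding mesh_occurrence_123_iff[OF \<pi>] by blast
    have "entry \<pi> b = entry \<pi> b'"
      using *(6) **(6) by linarith
    then have "b = b'"
      using entry_eq_iff[OF \<pi>, of b b'] *(2-4) **(2-4) by simp
    \<comment> \<open>Otherwise a' lies strictly between a and b, so its entry exceeds the last one,
      although it is smaller than \<open>entry \<pi> b\<close>.\<close>
    moreover have "\<not> a < a'"
      using *(7)[of a'] **(3,5,6) \<open>b = b'\<close> by auto
    moreover have "\<not> a' < a"
      using **(7)[of a] *(3,5,6) \<open>b = b'\<close> by auto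
    ultimately show "ix = ix'" using *(1) **(1) by simp
  qed
  also have "(\<exists>ix. mesh_occurrence ([1,2,3], mesh_R) \<pi> ix) \<longleftrightarrow>
    (\<exists>a b. 1 \<le> a \<and> a < b \<and> b < n \<and> entry \<pi> a < entry \<pi> b \<and> entry \<pi> n = entry \<pi> b + 1)"
  proof
    assume "\<exists>a b. 1 \<le> a \<and> a < b \<and> b < n \<and> entry \<pi> a < entry \<pi> b \<and> entry \<pi> n = entry \<pi> b + 1"
    then obtain a b where ab: "1 \<le> a" "a < b" "b < n" "entry \<pi> a < entry \<pi> b" "entry \<pi> n = entry \<pi> b + 1"
      by blast
    obtain a' where a': "1 \<le> a'" "a' < b" "entry \<pi> a' < entry \<pi> b"
      "\<And>m. a' < m \<Longrightarrow> m < b \<Longrightarrow> entry \<pi> b \<le> entry \<pi> m"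
      using nearest_smaller_exists[OF ab(1,2), of "entry \<pi>", OF ab(4)] by blast
    \<comment> \<open>The entry at m is at least \<open>entry \<pi> b\<close> and differs from it
      and from its successor \<open>entry \<pi> n\<close>.\<close>
    have "entry \<pi> n < entry \<pi> m" if "a' < m" "m < b" for m
    proof -
      have "entry \<pi> m \<noteq> entry \<pi> b" "entry \<pi> m \<noteq> entry \<pi> n"
        using that ab(3) by (simp_all add: entry_eq_iff[OF \<pi>])
      with a'(4)[OF that] ab(5) show ?thesis by linarith
    qed
    with a' ab show "\<exists>ix. mesh_occurrence ([1,2,3], mesh_R) \<pi> ix"
      unfolding mesh_occurrence_123_iff[OF \<pi>] by blast
  qed (auto simp: mesh_occurrence_123_iff[OF \<pi>])
  finally show ?thesis .
qed

text \<open>As for 123, but the threshold for the nearest smaller entry is the last entry, since the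
  middle entry is now its successor.\<close>

lemma mesh_count_132:
  assumes \<pi>: "\<pi> \<in> Sym n"
  shows "mesh_count ([1,3,2], mesh_R) \<pi> =
    of_bool (\<exists>a b. 1 \<le> a \<and> a < b \<and> b < n \<and> entry \<pi> a < entry \<pi> n \<and> entry \<pi> b = entry \<pi> n + 1)"
proof -
  have "mesh_count ([1,3,2], mesh_R) \<pi> = of_bool (\<exists>ix. mesh_occurrence ([1,3,2], mesh_R) \<pi> ix)"
  proof (rule mesh_count_eq_of_bool)
    fix ix ix'
    assume "mesh_occurrence ([1,3,2], mesh_R) \<pi> ix" "mesh_occurrence ([1,3,2], mesh_R) \<pi> ix'"
    then obtain a b a' b' where
      *: "ix = [a, b, n]" "1 \<le> a" "a < b" "b < n" "entry \<pi> a < entry \<pi> n"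
        "entry \<pi> b = entry \<pi> n + 1" "\<And>m. a < m \<Longrightarrow> m < b \<Longrightarrow> entry \<pi> b < entry \<pi> m" and
      **: "ix' = [a', b', n]" "1 \<le> a'" "a' < b'" "b' < n" "entry \<pi> a' < entry \<pi> n"
        "entry \<pi> b' = entry \<pi> n + 1" "\<And>m. a' < m \<Longrightarrow> m < b' \<Longrightarrow> entry \<pi> b' < entry \<pi> m"
      unfolding mesh_occurrence_132_iff[OF \<pi>] by blast
    have "entry \<pi> b = entry \<pi> b'"
      using *(6) **(6) by linarith
    then have "b = b'"
      using entry_eq_iff[OF \<pi>, of b b'] *(2-4) **(2-4) by simp
    moreover have "\<not> a < a'"
      using *(7)[of a'] **(3,5,6) \<open>b = b'\<close> by auto
    moreover have "\<not> a' < a"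
      using **(7)[of a] *(3,5,6) \<open>b = b'\<close> by auto
    ultimately show "ix = ix'" using *(1) **(1) by simp
  qed
  also have "(\<exists>ix. mesh_occurrence ([1,3,2], mesh_R) \<pi> ix) \<longleftrightarrow>
    (\<exists>a b. 1 \<le> a \<and> a < b \<and> b < n \<and> entry \<pi> a < entry \<pi> n \<and> entry \<pi> b = entry \<pi> n + 1)"
  proof
    assume "\<exists>a b. 1 \<le> a \<and> a < b \<and> b < n \<and> entry \<pi> a < entry \<pi> n \<and> entry \<pi> b = entry \<pi> n + 1"
    then obtain a b where ab: "1 \<le> a" "a < b" "b < n" "entry \<pi> a < entry \<pi> n" "entry \<pi> b = entry \<pi> n + 1"
      by blast
    obtain a' where a': "1 \<le> a'" "a' < b" "entry \<pi> a' < entry \<pi> n"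
      "\<And>m. a' < m \<Longrightarrow> m < b \<Longrightarrow> entry \<pi> n \<le> entry \<pi> m"
      using nearest_smaller_exists[OF ab(1,2), of "entry \<pi>", OF ab(4)] by blast
    have "entry \<pi> b < entry \<pi> m" if "a' < m" "m < b" for m
    proof -
      have "entry \<pi> m \<noteq> entry \<pi> b" "entry \<pi> m \<noteq> entry \<pi> n"
        using that ab(3) by (simp_all add: entry_eq_iff[OF \<pi>])
      with a'(4)[OF that] ab(5) show ?thesis by linarith
    qed
    with a' ab show "\<exists>ix. mesh_occurrence ([1,3,2], mesh_R) \<pi> ix"
      unfolding mesh_occurrence_132_iff[OF \<pi>] by blast
  qed (auto simp: mesh_occurrence_132_iff[OF \<pi>])
  finally show ?thesis .
qed

section \<open>The exchange of values\<close>

text \<open>Wrapping 1 around to n keeps the predecessor injective on {1..n}; this is what makes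
  \<open>lower_last\<close> invertible.\<close>

definition cyclic_pred :: "nat \<Rightarrow> nat \<Rightarrow> nat" where
  "cyclic_pred n z = (if z = 1 then n else z - 1)"

text \<open>Here x, y, z are the values at a, b, n. For z > 1 the exchange lowers the last value to
  z - 1, puts z where z - 1 stood and fixes all smaller values. For z = 1 both sides fail:
  \<open>t z = n\<close> leaves no room for \<open>t y = n + 1\<close>, and y is at least 1.\<close>

lemma transpose_cyclic_pred_iff:
  assumes "x \<in> {1..n}" "y \<in> {1..n}" "z \<in> {1..n}" "x \<noteq> z" "y \<noteq> z"
  defines "t \<equiv> transpose z (cyclic_pred n z)"
  shows "t x < t z \<and> t y = t z + 1 \<longleftrightarrow> x < y \<and> z = y + 1"
  using assms by (cases "z = 1") (auto simp: cyclic_pred_def transpose_def)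

definition lower_last :: "nat \<Rightarrow> nat list \<Rightarrow> nat list" where
  "lower_last n \<pi> = map (transpose (entry \<pi> n) (cyclic_pred n (entry \<pi> n))) \<pi>"

context
  fixes \<pi> n
  assumes \<pi>: "\<pi> \<in> Sym n"
begin

lemma entry_lower_last:
  "m \<in> {1..n} \<Longrightarrow>
     entry (lower_last n \<pi>) m = transpose (entry \<pi> n) (cyclic_pred n (entry \<pi> n)) (entry \<pi> m)"
  using length_Sym[OF \<pi>] by (simp add: lower_last_def entry_map)

lemma lower_last_mem: "lower_last n \<pi> \<in> Sym n"
proof (cases "n = 0")
  case False
  then have "entry \<pi> n \<in> {1..n}" "cyclic_pred n (entry \<pi> n) \<in> {1..n}"
    using entry_mem[OF \<pi>, of n] by (auto simp: cyclic_pred_def)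
  then show ?thesis
    unfolding lower_last_def
    by (intro map_mem_Sym \<pi>) (simp add: bij_betw_transpose_iff)
qed (use \<pi> in \<open>simp add: lower_last_def\<close>)

text \<open>The same positions a and b witness both indicators, by
  \<open>transpose_cyclic_pred_iff\<close> applied to their entries.\<close>

lemma mesh_count_lower_last:
  "mesh_count ([1,3,2], mesh_R) (lower_last n \<pi>) = mesh_count ([1,2,3], mesh_R) \<pi>"
proof -
  let ?z = "entry \<pi> n"
  have "(1 \<le> a \<and> a < b \<and> b < n \<and> entry (lower_last n \<pi>) a < entry (lower_last n \<pi>) n \<and>
          entry (lower_last n \<pi>) b = entry (lower_last n \<pi>) n + 1) \<longleftrightarrow>
        (1 \<le> a \<and> a < b \<and> b < n \<and> entry \<pi> a < entry \<pi> b \<and> ?z = entry \<pi> b + 1)" for a b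
  proof (cases "1 \<le> a \<and> a < b \<and> b < n")
    case True
    have mem: "a \<in> {1..n}" "b \<in> {1..n}" "n \<in> {1..n}"
      using True by auto
    then have "entry \<pi> a \<noteq> ?z" "entry \<pi> b \<noteq> ?z"
      using True by (simp_all add: entry_eq_iff[OF \<pi>])
    then show ?thesis
      using True transpose_cyclic_pred_iff[OF mem[THEN entry_mem[OF \<pi>]]]
      unfolding mem[THEN entry_lower_last] by blast
  qed blast
  then show ?thesis
    unfolding mesh_count_132[OF lower_last_mem] mesh_count_123[OF \<pi>] by (simp only:)
qed

end

lemma bij_betw_lower_last: "bij_betw (lower_last n) (Sym n) (Sym n)"
proof (cases "n = 0")
  case False
  have "inj_on (lower_last n) (Sym n)"
  proof (rule inj_onI)
    fix \<pi> \<rho> assume \<pi>: "\<pi> \<in> Sym n" and \<rho>: "\<rho> \<in> Sym n" and eq: "lower_last n \<pi> = lower_last n \<rho>"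
    \<comment> \<open>The image ends in the cyclic predecessor of the old last entry. This recovers
      the old entry, hence the transposition used, which can then be undone.\<close>
    have "cyclic_pred n (entry \<pi> n) = cyclic_pred n (entry \<rho> n)"
      using arg_cong[OF eq, of "\<lambda>xs. entry xs n"] False by (simp add: entry_lower_last \<pi> \<rho>)
    then have "entry \<pi> n = entry \<rho> n"
      using entry_mem[OF \<pi>, of n] entry_mem[OF \<rho>, of n] False
      by (auto simp: cyclic_pred_def split: if_splits)
    with eq show "\<pi> = \<rho>"
      unfolding lower_last_def by (metis bij_is_inj bij_transpose inj_map_eq_map)
  qed
  moreover have "lower_last n ` Sym n \<subseteq> Sym n"
    using lower_last_mem by blast
  ultimately show ?thesis
    by (metis bij_betw_def endo_inj_surj finite_permutations_of_set)
qed (simp add: lower_last_def)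

lemma jointly_equidistributed_mesh_R: "([1,2,3], mesh_R) \<sim>\<^sub>j\<^sub>d ([1,3,2], mesh_R)"
proof (rule jointly_equidistributed_if_01)
  show "mesh_count ([1,2,3], mesh_R) \<pi> \<le> 1 \<and> mesh_count ([1,3,2], mesh_R) \<pi> \<le> 1"
    if "\<pi> \<in> Sym n" for n \<pi>
    by (simp add: mesh_count_123[OF that] mesh_count_132[OF that] of_bool_def)
  show "card {\<pi> \<in> Sym n. mesh_count ([1,2,3], mesh_R) \<pi> = 1} =
        card {\<pi> \<in> Sym n. mesh_count ([1,3,2], mesh_R) \<pi> = 1}" for n
    by (rule bij_betw_same_card[OF bij_betw_Collect[OF bij_betw_lower_last]])
      (simp add: mesh_count_lower_last)
qed

section \<open>The patterns with shading \<open>R'\<close>\<close>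

lemma mesh_R'_eq: "mesh_R' = mesh_R\<inverse>"
  by (auto simp: mesh_R_def mesh_R'_def)

lemma mem_Sym_3: "[1,2,3] \<in> Sym 3" "[1,3,2] \<in> Sym 3"
  by (auto simp: permutations_of_set_def numeral_3_eq_3 atLeastAtMost_insertL)

text \<open>Every v in {1..n} is an entry of \<open>\<pi>\<close>, so a left inverse is the inverse;
  for explicit lists this replaces evaluating \<open>inv_into\<close>.\<close>

lemma inv_list_eqI:
  assumes \<pi>: "\<pi> \<in> Sym n" and "length \<rho> = n"
    and "\<And>m. m \<in> {1..n} \<Longrightarrow> entry \<pi> m \<in> {1..n} \<Longrightarrow> entry \<rho> (entry \<pi> m) = m"
  shows "inv_list \<pi> = \<rho>"
proof (rule list_eq_if_entry_eq[of _ n])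
  fix v assume "v \<in> {1..n}"
  then obtain m where "m \<in> {1..n}" "entry \<pi> m = v"
    using entry_surj[OF \<pi>] by blast
  with assms(3)[of m] entry_mem[OF \<pi>, of m] show "entry (inv_list \<pi>) v = entry \<rho> v"
    using entry_inv_list_entry[OF \<pi>, of m] by simp
qed (use assms in \<open>simp_all add: length_Sym\<close>)

lemma inv_list_3: "inv_list [1,2,3] = [1,2,3]" "inv_list [1,3,2] = [1,3,2]"
  by (rule inv_list_eqI[OF mem_Sym_3(1)]; auto simp: entry_def nth_Cons' numeral_eq_Suc One_nat_def)
    (rule inv_list_eqI[OF mem_Sym_3(2)]; auto simp: entry_def nth_Cons' numeral_eq_Suc One_nat_def)

theorem theorem6p2:
  shows "([1,2,3], mesh_R) \<sim>\<^sub>j\<^sub>d ([1,3,2], mesh_R) \<and>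
         ([1,2,3], mesh_R') \<sim>\<^sub>j\<^sub>d ([1,3,2], mesh_R')"
  using jointly_equidistributed_mesh_R
    jointly_equidistributed_transpose[OF mem_Sym_3 jointly_equidistributed_mesh_R]
  by (simp add: inv_list_3 mesh_R'_eq)

end
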